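(* The map $$p_*:\Omega\longrightarrow(0,1),\qquad (u,v,w)\longmapsto p_*(u,v,w),$$ is of class $C^\infty$.
   Context: For $(u,v,w)\in(0,1)^3$ and $p>0$, define $$h(u,v,w,p)=\ln(1-u^p)+\ln(1-v^p)-2\ln\bigl(1-(uv)^p\bigr)-p\ln w,$$ and let $$\Omega=\bigl\{(u,v,w)\in(0,1)^3: h(u,v,w,1)>0\bigr\},$$ which is an open subset of $(0,1)^3$. For each $(u,v,w)\in\Omega$, the equation $h(u,v,w,p)=0$ (in the unknown $p>0$) has a unique solution, denoted $p_*(u,v,w)$, and it lies in $(0,1)$; this defines the map $p_*$. *)

theory Defs
  imports "HOL-Analysis.Analysis"
begin

definition h :: "real \<Rightarrow> real \<Rightarrow> real \<Rightarrow> real \<Rightarrow> real" where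
  "h u v w p = ln (1 - u powr p) + ln (1 - v powr p) - 2 * ln (1 - (u * v) powr p) - p * ln w"

definition Omega :: "(real \<times> real \<times> real) set" where
  "Omega = {(u, v, w). u \<in> {0<..<1} \<and> v \<in> {0<..<1} \<and> w \<in> {0<..<1} \<and> h u v w 1 > 0}"

text \<open>Outside \<open>Omega\<close> the value of \<open>p_star\<close> is irrelevant; on \<open>Omega\<close> the description is
  meaningful by the lemma \<open>p_star_well_defined\<close> below.\<close>

definition p_star :: "real \<times> real \<times> real \<Rightarrow> real" where
  "p_star = (\<lambda>(u, v, w). THE p. p > 0 \<and> h u v w p = 0)"

text \<open>\<open>Ck_on k f S\<close> is intended for open \<open>S\<close> only: there \<^term>\<open>at x\<close> (no \<open>within S\<close>) is the right
  filter and the derivative depends only on \<open>f\<close> restricted to \<open>S\<close>. Quantifying over all directions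
  \<open>d\<close> says that all iterated directional (in particular partial) derivatives of order up to \<open>k\<close>
  exist and are continuous on \<open>S\<close>.\<close>

primrec Ck_on :: "nat \<Rightarrow> ('a::euclidean_space \<Rightarrow> 'b::real_normed_vector) \<Rightarrow> 'a set \<Rightarrow> bool" where
  "Ck_on 0 f S \<longleftrightarrow> continuous_on S f"
| "Ck_on (Suc k) f S \<longleftrightarrow>
     (\<forall>x\<in>S. f differentiable (at x)) \<and> (\<forall>d. Ck_on k (\<lambda>x. frechet_derivative f (at x) d) S)"

definition C_infinity_on :: "('a::euclidean_space \<Rightarrow> 'b::real_normed_vector) \<Rightarrow> 'a set \<Rightarrow> bool" where
  "C_infinity_on f S \<longleftrightarrow> (\<forall>k. Ck_on k f S)"

lemma open_Omega: "open Omega"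
proof -
  define Q where "Q = {0<..<1::real} \<times> {0<..<1::real} \<times> {0<..<1::real}"
  have oQ: "open Q"
    unfolding Q_def by (intro open_Times) auto
  have uv: "u * v \<noteq> 1" if "0 < u" "u < 1" "0 < v" "v < 1" for u v :: real
    using mult_strict_mono[of u 1 v 1] that by auto
  have "continuous_on Q (\<lambda>x. h (fst x) (fst (snd x)) (snd (snd x)) 1)"
    unfolding h_def
    by (intro continuous_intros) (auto simp: Q_def dest: uv)
  then have "open ((\<lambda>x. h (fst x) (fst (snd x)) (snd (snd x)) 1) -` {0<..} \<inter> Q)"
    using oQ by (simp add: continuous_on_open_vimage)
  also have "(\<lambda>x. h (fst x) (fst (snd x)) (snd (snd x)) 1) -` {0<..} \<inter> Q = Omega"
    by (auto simp: Omega_def Q_def)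
  finally show ?thesis .
qed

lemma mono_aux:
  fixes x y :: real
  assumes "0 < x" "x \<le> y" "y < 1"
  shows "- x * ln x / (1 - x) \<le> - y * ln y / (1 - y)"
proof (rule DERIV_nonneg_imp_nondecreasing[OF assms(2)])
  fix t assume t: "x \<le> t" "t \<le> y"
  then have t01: "0 < t" "t < 1" using assms by auto
  have "((\<lambda>t. - t * ln t / (1 - t)) has_real_derivative (t - 1 - ln t) / (1 - t)^2) (at t)"
    using t01
    by (auto intro!: derivative_eq_intros simp: power2_eq_square field_simps)
       (simp add: divide_simps algebra_simps)
  moreover have "(t - 1 - ln t) / (1 - t)^2 \<ge> 0"
    using ln_le_minus_one[OF t01(1)] by simp
  ultimately show "\<exists>D. ((\<lambda>t. - t * ln t / (1 - t)) has_real_derivative D) (at t) \<and> 0 \<le> D"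
    by blast
qed

lemma powr_lt_one:
  fixes u p :: real
  assumes "0 < u" "u < 1" "0 < p"
  shows "u powr p < 1"
  using assms powr_less_mono2[of p u 1] by simp

lemma h_has_derivative:
  assumes "0 < u" "u < 1" "0 < v" "v < 1" "0 < w" "w < 1" "0 < p"
  shows "\<exists>D>0. (h u v w has_real_derivative D) (at p)"
proof -
  let ?x = "u powr p" and ?y = "v powr p" and ?z = "(u * v) powr p"
  have uv: "0 < u * v" "u * v < 1"
    using assms mult_strict_mono[of u 1 v 1] by auto
  have lt: "?x < 1" "?y < 1" "?z < 1"
    using assms uv by (auto intro: powr_lt_one)
  have zxy: "?z = ?x * ?y" using assms by (simp add: powr_mult)
  have pos: "0 < ?x" "0 < ?y" "0 < ?z" using assms by auto
  have le: "?z \<le> ?x" "?z \<le> ?y"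
    using pos lt zxy by (auto intro: mult_right_le_one_le mult_left_le_one_le)
  define D where "D = - ?x * ln u / (1 - ?x) - ?y * ln v / (1 - ?y)
                      + 2 * ?z * ln (u * v) / (1 - ?z) - ln w"
  have d: "(h u v w has_real_derivative D) (at p)"
    unfolding h_def D_def
    using assms uv lt by (auto intro!: derivative_eq_intros simp: field_simps)
  have "p * (D + ln w) = - ?x * ln ?x / (1 - ?x) + - ?y * ln ?y / (1 - ?y)
                      - 2 * (- ?z * ln ?z / (1 - ?z))"
    unfolding D_def using assms uv lt
    by (simp add: ln_powr algebra_simps del: mult_minus_left)
  also have "\<dots> \<ge> 0"
    using mono_aux[OF pos(3) le(1) lt(1)] mono_aux[OF pos(3) le(2) lt(2)] by linarith
  finally have "D + ln w \<ge> 0" using assms(7) by (simp add: zero_le_mult_iff)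
  moreover have "ln w < 0" using assms by simp
  ultimately have "D > 0" by linarith
  then show ?thesis using d by blast
qed

lemma h_strict_mono:
  assumes "0 < u" "u < 1" "0 < v" "v < 1" "0 < w" "w < 1" "0 < p" "p < q"
  shows "h u v w p < h u v w q"
proof (rule DERIV_pos_imp_increasing[OF assms(8)])
  fix x assume "p \<le> x" "x \<le> q"
  then show "\<exists>D. (h u v w has_real_derivative D) (at x) \<and> 0 < D"
    using h_has_derivative[OF assms(1-6), of x] assms(7) by auto
qed

lemma h_neg_near_0:
  assumes "0 < u" "u < 1" "0 < v" "v < 1" "0 < w" "w < 1"
  shows "\<exists>p>0. p < 1 \<and> h u v w p < 0"
proof -
  define p where "p = 1 / (1 - ln u - ln w)"
  have l: "ln u < 0" "ln w < 0" using assms by auto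
  then have p: "0 < p" "p < 1" by (auto simp: p_def field_simps)
  have p_eq: "p * (- ln u - ln w) = 1 - p" using l by (simp add: p_def field_simps)
  let ?x = "u powr p" and ?y = "v powr p"
  have lt: "0 < ?x" "0 < ?y" "?x < 1" "?y < 1"
    using assms p by (auto intro: powr_lt_one)
  have xy: "?x * ?y < 1" using lt mult_strict_mono[of ?x 1 ?y 1] by simp
  have "0 \<le> ((1 - ?x) - ?x * (1 - ?y))^2" by simp
  then have "4 * ?x * ((1 - ?x) * (1 - ?y)) \<le> (1 - ?x * ?y)^2"
    by (simp add: power2_eq_square algebra_simps)
  then have "ln (4 * ?x * ((1 - ?x) * (1 - ?y))) \<le> ln ((1 - ?x * ?y)^2)"
    using lt xy by (subst ln_le_cancel_iff) auto
  then have "ln 4 + p * ln u + ln (1 - ?x) + ln (1 - ?y) \<le> 2 * ln (1 - ?x * ?y)"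
  proof -
    have "ln (4 * ?x * ((1 - ?x) * (1 - ?y)))
        = ln 4 + ln ?x + (ln (1 - ?x) + ln (1 - ?y))"
      using lt by (subst ln_mult, simp, simp, subst ln_mult, simp, simp, subst ln_mult) auto
    moreover have "ln ((1 - ?x * ?y)^2) = 2 * ln (1 - ?x * ?y)"
      using xy by (simp add: ln_realpow)
    ultimately show ?thesis
      using \<open>ln (4 * ?x * ((1 - ?x) * (1 - ?y))) \<le> ln ((1 - ?x * ?y)^2)\<close> assms
      by (simp add: ln_powr)
  qed
  then have "h u v w p \<le> p * (- ln u - ln w) - ln 4"
    using assms by (simp add: h_def powr_mult algebra_simps)
  also have "\<dots> < 1 - ln 4" using p_eq p by simp
  also have "(1::real) \<le> ln 4"
    using ln_ge_iff[of 4 1] exp_le by simp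
  finally show ?thesis using p by auto
qed

lemma p_star_well_defined:
  assumes "(u, v, w) \<in> Omega"
  shows "\<exists>!p. p > 0 \<and> h u v w p = 0"
    and "p > 0 \<Longrightarrow> h u v w p = 0 \<Longrightarrow> p < 1"
proof -
  have a: "0 < u" "u < 1" "0 < v" "v < 1" "0 < w" "w < 1" and h1: "h u v w 1 > 0"
    using assms by (auto simp: Omega_def)
  obtain q where q: "0 < q" "q < 1" "h u v w q < 0" using h_neg_near_0[OF a] by blast
  have "\<exists>p\<ge>q. p \<le> 1 \<and> h u v w p = 0"
  proof (rule IVT)
    show "\<forall>x. q \<le> x \<and> x \<le> 1 \<longrightarrow> isCont (h u v w) x"
      using h_has_derivative[OF a] q by (meson DERIV_isCont less_le_trans)
  qed (use q h1 in auto)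
  then obtain p where "p > 0" "h u v w p = 0" using q by (meson less_le_trans)
  then show "\<exists>!p. p > 0 \<and> h u v w p = 0"
    using h_strict_mono[OF a] by (metis less_irrefl linorder_neqE)
  show "p < 1" if "p > 0" "h u v w p = 0" for p
    using h_strict_mono[OF a, of 1 p] that h1 by (cases p "1::real" rule: linorder_cases) auto
qed

end

theory Submission
  imports Defs
begin

text \<open>
  The map \<open>p_star\<close> solves the implicit equation \<open>h u v w p = 0\<close>, so its smoothness is an instance
  of the implicit function theorem. Existence and uniqueness of the solution being known, only the
  regularity part of that theorem has to be supplied: a \<^emph>\<open>continuous\<close> solution \<open>g\<close> of
  \<open>F (x, g x) = 0\<close> with \<open>F\<close> smooth and \<open>\<partial>F/\<partial>p\<close> nowhere zero on the graph is smooth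
  (\<open>Ck_on_implicit\<close>).

  The reason is a bootstrap. Linearising \<open>F\<close> along the graph shows that \<open>g\<close> is differentiable with
  \<open>g'(x) d = - F'(x, g x) (d, 0) / F'(x, g x) (0, 1)\<close> (\<open>has_derivative_implicit\<close>). The right-hand
  side is a smooth function composed with \<open>x \<mapsto> (x, g x)\<close>, so it is as regular as \<open>g\<close> itself: if
  \<open>g\<close> is of class \<open>C\<^sup>k\<close>, so are its directional derivatives, and \<open>g\<close> is of class \<open>C\<^sup>k\<^sup>+\<^sup>1\<close>. This needs
  the closure of \<open>Ck_on\<close> under composition and the elementary operations.

  For \<open>h\<close>, strict monotonicity in \<open>p\<close> yields the continuity of \<open>p_star\<close>, by trapping the zero
  between two nearby values of \<open>p\<close> where \<open>h\<close> has opposite signs, and \<open>\<partial>h/\<partial>p > 0\<close> is the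
  nondegeneracy condition.
\<close>

section \<open>Calculus of \<open>C\<^sup>k\<close> maps on open sets\<close>

lemma Ck_on_has_derivative:
  assumes "Ck_on (Suc k) f S" "x \<in> S"
  shows "(f has_derivative frechet_derivative f (at x)) (at x)"
  using assms by (simp add: frechet_derivative_works)

lemma Ck_on_cong_imp:
  assumes "open S" "\<And>x. x \<in> S \<Longrightarrow> f x = g x" "Ck_on k f S"
  shows "Ck_on k g S"
  using assms(2,3)
proof (induction k arbitrary: f g)
  case 0
  then show ?case by (metis Ck_on.simps(1) continuous_on_cong)
next
  case (Suc k)
  have g: "(g has_derivative frechet_derivative f (at x)) (at x)" if "x \<in> S" for x
    using has_derivative_transform_within_open[OF Ck_on_has_derivative[OF Suc.prems(2) that]
        assms(1) that Suc.prems(1)] .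
  have eq: "frechet_derivative f (at x) d = frechet_derivative g (at x) d" if "x \<in> S" for x d
    using frechet_derivative_at[OF g[OF that]] by simp
  have "Ck_on k (\<lambda>x. frechet_derivative g (at x) d) S" for d
  proof (rule Suc.IH)
    show "Ck_on k (\<lambda>x. frechet_derivative f (at x) d) S" using Suc.prems(2) by simp
  qed (rule eq)
  then show ?case using g by (auto simp: differentiable_def)
qed

lemma Ck_on_SucI:
  assumes "open S" "\<And>x. x \<in> S \<Longrightarrow> (f has_derivative f' x) (at x)"
    and "\<And>d. Ck_on k (\<lambda>x. f' x d) S"
  shows "Ck_on (Suc k) f S"
proof -
  have eq: "f' x d = frechet_derivative f (at x) d" if "x \<in> S" for x d
    using frechet_derivative_at[OF assms(2)[OF that]] by simp
  have "Ck_on k (\<lambda>x. frechet_derivative f (at x) d) S" for d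
    using Ck_on_cong_imp[OF assms(1) eq assms(3)] .
  then show ?thesis using assms(2) by (auto simp: differentiable_def)
qed

lemma Ck_on_Suc_imp:
  "Ck_on (Suc k) f S \<Longrightarrow> Ck_on k f S"
proof (induction k arbitrary: f)
  case 0
  then show ?case
    by (auto intro!: differentiable_imp_continuous_on
        simp: differentiable_on_def differentiable_at_withinI)
next
  case (Suc k)
  then show ?case by (metis Ck_on.simps(2))
qed

lemma Ck_on_const: "open S \<Longrightarrow> Ck_on k (\<lambda>x. c) S"
proof (induction k arbitrary: c)
  case (Suc k)
  show ?case
    by (rule Ck_on_SucI[OF Suc.prems has_derivative_const]) (rule Suc.IH[OF Suc.prems])
qed simp

lemma Ck_on_ident: "open S \<Longrightarrow> Ck_on k (\<lambda>x. x) S"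
proof (cases k)
  case (Suc m)
  assume "open S"
  then show ?thesis unfolding Suc
    by (intro Ck_on_SucI[OF _ has_derivative_ident]) (auto intro: Ck_on_const)
qed simp

lemma Ck_on_linear:
  assumes L: "bounded_linear L" and "open S" "Ck_on k f S"
  shows "Ck_on k (\<lambda>x. L (f x)) S"
  using assms(3)
proof (induction k arbitrary: f)
  case 0
  then show ?case by (simp add: bounded_linear.continuous_on[OF L])
next
  case (Suc k)
  show ?case
  proof (rule Ck_on_SucI[OF assms(2)])
    show "((\<lambda>x. L (f x)) has_derivative (\<lambda>d. L (frechet_derivative f (at x) d))) (at x)"
      if "x \<in> S" for x
      by (rule bounded_linear.has_derivative[OF L Ck_on_has_derivative[OF Suc.prems that]])
    show "Ck_on k (\<lambda>x. L (frechet_derivative f (at x) d)) S" for d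
      using Suc by simp
  qed
qed

lemma Ck_on_add:
  assumes "open S" "Ck_on k f S" "Ck_on k g S"
  shows "Ck_on k (\<lambda>x. f x + g x) S"
  using assms(2,3)
proof (induction k arbitrary: f g)
  case 0
  then show ?case by (simp add: continuous_on_add)
next
  case (Suc k)
  show ?case
  proof (rule Ck_on_SucI[OF assms(1)])
    show "((\<lambda>x. f x + g x) has_derivative
        (\<lambda>d. frechet_derivative f (at x) d + frechet_derivative g (at x) d)) (at x)"
      if "x \<in> S" for x
      using Suc.prems that by (intro has_derivative_add Ck_on_has_derivative)
    show "Ck_on k (\<lambda>x. frechet_derivative f (at x) d + frechet_derivative g (at x) d) S" for d
      using Suc by simp
  qed
qed

lemma Ck_on_Pair:
  assumes "open S" "Ck_on k f S" "Ck_on k g S"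
  shows "Ck_on k (\<lambda>x. (f x, g x)) S"
  using assms(2,3)
proof (induction k arbitrary: f g)
  case 0
  then show ?case by (simp add: continuous_on_Pair)
next
  case (Suc k)
  show ?case
  proof (rule Ck_on_SucI[OF assms(1)])
    show "((\<lambda>x. (f x, g x)) has_derivative
        (\<lambda>d. (frechet_derivative f (at x) d, frechet_derivative g (at x) d))) (at x)"
      if "x \<in> S" for x
      using Suc.prems that by (intro has_derivative_Pair Ck_on_has_derivative)
    show "Ck_on k (\<lambda>x. (frechet_derivative f (at x) d, frechet_derivative g (at x) d)) S" for d
      using Suc by simp
  qed
qed

lemma Ck_on_sum:
  assumes "open S" "\<And>i. i \<in> I \<Longrightarrow> Ck_on k (f i) S"
  shows "Ck_on k (\<lambda>x. \<Sum>i\<in>I. f i x) S"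
  using assms(2)
  by (induction I rule: infinite_finite_induct) (auto intro!: Ck_on_const Ck_on_add assms(1))

lemma Ck_on_bilinear:
  assumes B: "bounded_bilinear B" and "open S" "Ck_on k f S" "Ck_on k g S"
  shows "Ck_on k (\<lambda>x. B (f x) (g x)) S"
  using assms(3,4)
proof (induction k arbitrary: f g)
  case 0
  then show ?case by (simp add: bounded_bilinear.continuous_on[OF B])
next
  case (Suc k)
  show ?case
  proof (rule Ck_on_SucI[OF assms(2)])
    show "((\<lambda>x. B (f x) (g x)) has_derivative
        (\<lambda>d. B (f x) (frechet_derivative g (at x) d) + B (frechet_derivative f (at x) d) (g x)))
        (at x)" if "x \<in> S" for x
      using Suc.prems that by (intro bounded_bilinear.FDERIV[OF B] Ck_on_has_derivative)
    show "Ck_on k (\<lambda>x. B (f x) (frechet_derivative g (at x) d)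
        + B (frechet_derivative f (at x) d) (g x)) S" for d
      using Suc.prems Ck_on_Suc_imp[OF Suc.prems(1)] Ck_on_Suc_imp[OF Suc.prems(2)]
      by (intro Ck_on_add[OF assms(2)] Suc.IH) auto
  qed
qed

lemmas Ck_on_mult = Ck_on_bilinear[OF bounded_bilinear_mult]

lemma Ck_on_minus: "open S \<Longrightarrow> Ck_on k f S \<Longrightarrow> Ck_on k (\<lambda>x. - f x) S"
  by (rule Ck_on_linear[OF bounded_linear_minus[OF bounded_linear_ident]])

lemma Ck_on_diff:
  "open S \<Longrightarrow> Ck_on k f S \<Longrightarrow> Ck_on k g S \<Longrightarrow> Ck_on k (\<lambda>x. f x - g x) S"
  using Ck_on_add[of S k f "\<lambda>x. - g x"] Ck_on_minus[of S k g] by simp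

text \<open>
  In the chain rule the direction \<open>\<phi>' x d\<close> varies with \<open>x\<close>, whereas \<open>Ck_on\<close> only speaks of the
  derivative of \<open>F\<close> in fixed directions; expanding \<open>\<phi>' x d\<close> in the standard basis reduces the former
  to the latter and keeps the induction going.
\<close>

lemma Ck_on_compose:
  fixes \<phi> :: "'a::euclidean_space \<Rightarrow> 'b::euclidean_space"
  assumes "open S" "open U" "\<phi> ` S \<subseteq> U" "Ck_on k F U" "Ck_on k \<phi> S"
  shows "Ck_on k (\<lambda>x. F (\<phi> x)) S"
  using assms(4,5)
proof (induction k arbitrary: F)
  case 0
  then show ?case using continuous_on_compose2[OF _ _ assms(3)] by auto
next
  case (Suc k)
  let ?D = "\<lambda>x. frechet_derivative F (at (\<phi> x))" and ?d = "\<lambda>x. frechet_derivative \<phi> (at x)"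
  show ?case
  proof (rule Ck_on_SucI[OF assms(1)])
    fix x assume x: "x \<in> S"
    then have F: "(F has_derivative ?D x) (at (\<phi> x))"
      using assms(3) by (intro Ck_on_has_derivative[OF Suc.prems(1)]) auto
    have lin: "linear (?D x)" using has_derivative_linear[OF F] .
    have "?D x (?d x d) = (\<Sum>b\<in>Basis. (?d x d \<bullet> b) *\<^sub>R ?D x b)" for d
    proof -
      have "?D x (?d x d) = ?D x (\<Sum>b\<in>Basis. (?d x d \<bullet> b) *\<^sub>R b)"
        by (simp add: euclidean_representation)
      also have "\<dots> = (\<Sum>b\<in>Basis. (?d x d \<bullet> b) *\<^sub>R ?D x b)"
        by (simp add: linear_sum[OF lin] linear_scale[OF lin])
      finally show ?thesis .
    qed
    then show "((\<lambda>x. F (\<phi> x)) has_derivative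
        (\<lambda>d. \<Sum>b\<in>Basis. (?d x d \<bullet> b) *\<^sub>R ?D x b)) (at x)"
      using has_derivative_compose[OF Ck_on_has_derivative[OF Suc.prems(2) x] F] by simp
  next
    fix d
    show "Ck_on k (\<lambda>x. \<Sum>b\<in>Basis. (?d x d \<bullet> b) *\<^sub>R ?D x b) S"
    proof (intro Ck_on_sum[OF assms(1)]
        Ck_on_bilinear[OF bounded_bilinear_scaleR assms(1)])
      fix b :: 'b
      show "Ck_on k (\<lambda>x. ?d x d \<bullet> b) S"
        using Suc.prems(2)
        by (intro Ck_on_linear[OF bounded_linear_inner_left assms(1)]) simp
      show "Ck_on k (\<lambda>x. ?D x b) S"
        using Suc.prems(1) Ck_on_Suc_imp[OF Suc.prems(2)] by (intro Suc.IH) auto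
    qed
  qed
qed

lemma Ck_on_exp:
  fixes f :: "'a::euclidean_space \<Rightarrow> real"
  assumes "open S" "Ck_on k f S"
  shows "Ck_on k (\<lambda>x. exp (f x)) S"
  using assms(2)
proof (induction k)
  case 0
  then show ?case by (simp add: continuous_on_exp)
next
  case (Suc k)
  show ?case
  proof (rule Ck_on_SucI[OF assms(1)])
    show "((\<lambda>x. exp (f x)) has_derivative (\<lambda>d. frechet_derivative f (at x) d * exp (f x))) (at x)"
      if "x \<in> S" for x
      using has_derivative_exp[OF Ck_on_has_derivative[OF Suc.prems that]] by (simp add: mult_ac)
    show "Ck_on k (\<lambda>x. frechet_derivative f (at x) d * exp (f x)) S" for d
      using Suc.prems Ck_on_Suc_imp[OF Suc.prems] by (intro Ck_on_mult assms(1) Suc.IH) auto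
  qed
qed

lemma Ck_on_inverse:
  fixes f :: "'a::euclidean_space \<Rightarrow> real"
  assumes "open S" "Ck_on k f S" "\<And>x. x \<in> S \<Longrightarrow> f x \<noteq> 0"
  shows "Ck_on k (\<lambda>x. inverse (f x)) S"
  using assms(2)
proof (induction k)
  case 0
  then show ?case using assms(3) by (simp add: continuous_on_inverse)
next
  case (Suc k)
  show ?case
  proof (rule Ck_on_SucI[OF assms(1)])
    show "((\<lambda>x. inverse (f x)) has_derivative
        (\<lambda>d. - (inverse (f x) * frechet_derivative f (at x) d * inverse (f x)))) (at x)"
      if "x \<in> S" for x
      using Deriv.has_derivative_inverse[OF assms(3)[OF that] Ck_on_has_derivative[OF Suc.prems that]] .
    show "Ck_on k (\<lambda>x. - (inverse (f x) * frechet_derivative f (at x) d * inverse (f x))) S" for d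
      using Suc.prems Ck_on_Suc_imp[OF Suc.prems]
      by (intro Ck_on_minus Ck_on_mult assms(1) Suc.IH) auto
  qed
qed

lemma Ck_on_ln:
  fixes f :: "'a::euclidean_space \<Rightarrow> real"
  assumes "open S" "Ck_on k f S" "\<And>x. x \<in> S \<Longrightarrow> 0 < f x"
  shows "Ck_on k (\<lambda>x. ln (f x)) S"
proof (cases k)
  case 0
  then show ?thesis using assms by (force intro!: continuous_on_ln)
next
  case (Suc m)
  note f = assms(2)[unfolded Suc]
  show ?thesis unfolding Suc
  proof (rule Ck_on_SucI[OF assms(1)])
    show "((\<lambda>x. ln (f x)) has_derivative
        (\<lambda>d. frechet_derivative f (at x) d * inverse (f x))) (at x)" if "x \<in> S" for x
      using has_derivative_ln[OF assms(3)[OF that] Ck_on_has_derivative[OF f that]] .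
    have "f x \<noteq> 0" if "x \<in> S" for x using assms(3)[OF that] by simp
    then show "Ck_on m (\<lambda>x. frechet_derivative f (at x) d * inverse (f x)) S" for d
      using f Ck_on_Suc_imp[OF f] by (intro Ck_on_mult Ck_on_inverse assms(1)) auto
  qed
qed

lemma Ck_on_powr:
  fixes f g :: "'a::euclidean_space \<Rightarrow> real"
  assumes "open S" "Ck_on k f S" "Ck_on k g S" "\<And>x. x \<in> S \<Longrightarrow> 0 < f x"
  shows "Ck_on k (\<lambda>x. f x powr g x) S"
proof (rule Ck_on_cong_imp[OF assms(1)])
  show "Ck_on k (\<lambda>x. exp (g x * ln (f x))) S"
    using assms by (intro Ck_on_exp Ck_on_mult Ck_on_ln)
  show "exp (g x * ln (f x)) = f x powr g x" if "x \<in> S" for x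
    using assms(4)[OF that] by (simp add: powr_def)
qed

section \<open>Regularity of implicitly defined functions\<close>

text \<open>
  Trapping argument: \<open>F (a, p)\<close> has opposite signs at \<open>p = g a \<plusminus> \<epsilon>\<close>, and for \<open>x\<close> near \<open>a\<close>
  these are also the signs of \<open>F (x, p)\<close>; by monotonicity the zero \<open>g x\<close> then lies between \<open>g a - \<epsilon>\<close> and \<open>g a + \<epsilon>\<close>.
\<close>

lemma continuous_on_zero_of_strict_mono:
  fixes F :: "'a::t2_space \<times> real \<Rightarrow> real"
  assumes "open S" "open P" and cont: "continuous_on (S \<times> P) F"
    and mono: "\<And>x. x \<in> S \<Longrightarrow> strict_mono_on P (\<lambda>p. F (x, p))"
    and g: "\<And>x. x \<in> S \<Longrightarrow> g x \<in> P" "\<And>x. x \<in> S \<Longrightarrow> F (x, g x) = 0"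
  shows "continuous_on S g"
proof -
  have "isCont g a" if a: "a \<in> S" for a
    unfolding isCont_def
  proof (rule tendstoI)
    fix e :: real assume "0 < e"
    obtain r where r: "0 < r" "cball (g a) r \<subseteq> P"
      using assms(2) g(1)[OF a] by (auto simp: open_contains_cball)
    \<comment> \<open>\<open>s\<close> keeps the two trapping values inside \<open>P\<close>, where \<open>F\<close> is continuous and monotone\<close>
    define s where "s = min r (e / 2)"
    have s: "0 < s" "s < e" using r \<open>0 < e\<close> by (auto simp: s_def)
    have P: "g a - s \<in> P" "g a + s \<in> P"
      using r s(1) by (auto simp: s_def dist_real_def intro!: subsetD[OF r(2)])
    have lim: "((\<lambda>x. F (x, q)) \<longlongrightarrow> F (a, q)) (at a)" if "q \<in> P" for q
    proof -
      have "continuous_on S (\<lambda>x. F (x, q))"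
        using that by (intro continuous_on_compose2[OF cont]) (auto intro!: continuous_intros)
      then show ?thesis
        using a assms(1) by (simp add: continuous_on_eq_continuous_at isCont_def)
    qed
    have "F (a, g a - s) < F (a, g a)" "F (a, g a) < F (a, g a + s)"
      using s P g(1)[OF a] by (auto intro!: strict_mono_onD[OF mono[OF a]])
    then have "F (a, g a - s) < 0" "0 < F (a, g a + s)" using g(2)[OF a] by auto
    then have "\<forall>\<^sub>F x in at a. F (x, g a - s) < 0" "\<forall>\<^sub>F x in at a. 0 < F (x, g a + s)"
      using order_tendstoD(2)[OF lim[OF P(1)]] order_tendstoD(1)[OF lim[OF P(2)]] by auto
    moreover have "\<forall>\<^sub>F x in at a. x \<in> S"
      using eventually_at_in_open'[OF assms(1) a] .
    ultimately show "\<forall>\<^sub>F x in at a. dist (g x) (g a) < e"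
    proof eventually_elim
      case (elim x)
      have less: "p < q" if "p \<in> P" "q \<in> P" "F (x, p) < F (x, q)" for p q
        using strict_mono_on_less[OF mono[OF elim(3)] that(1,2)] that(3) by simp
      have "g a - s < g x" "g x < g a + s"
        using less[OF P(1) g(1)] less[OF g(1) P(2)] elim g(2) by simp_all
      then show ?case using s by (auto simp: dist_real_def)
    qed
  qed
  then show ?thesis by (simp add: continuous_at_imp_continuous_on)
qed

text \<open>
  With \<open>n = norm (x - a)\<close>, \<open>q = g x - g a\<close>, \<open>A d = F' (d, 0)\<close> and \<open>B = F' (0, 1)\<close>, the equation
  \<open>F (x, g x) = F (a, g a)\<close> says that \<open>A (x - a) + q * B\<close> is an error term \<open>\<epsilon> * (n + \<bar>q\<bar>)\<close>. A first,
  crude use of this (\<open>\<epsilon> \<le> \<bar>B\<bar> / 2\<close>) absorbs the \<open>\<bar>q\<bar>\<close> on the right and shows that \<open>g\<close> is Lipschitz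
  at \<open>a\<close>; the error is then \<open>o n\<close>, which is the claim after division by \<open>B\<close>.
\<close>

lemma has_derivative_implicit:
  fixes F :: "'a::real_normed_vector \<times> real \<Rightarrow> real"
  assumes F: "(F has_derivative F') (at (a, g a))" and nz: "F' (0, 1) \<noteq> 0"
    and cont: "isCont g a" and level: "\<forall>\<^sub>F x in nhds a. F (x, g x) = F (a, g a)"
  shows "(g has_derivative (\<lambda>d. - F' (d, 0) / F' (0, 1))) (at a)"
proof -
  define B where "B = F' (0, 1)"
  have B: "0 < \<bar>B\<bar>" using nz by (simp add: B_def)
  have bl: "bounded_linear F'" using has_derivative_bounded_linear[OF F] .
  have blA: "bounded_linear (\<lambda>d. F' (d, 0))"
    using bounded_linear_compose[OF bl bounded_linear_Pair[OF bounded_linear_ident bounded_linear_zero]] .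
  obtain K where K: "0 \<le> K" "\<And>d. \<bar>F' (d, 0)\<bar> \<le> K * norm d"
    using bounded_linear.nonneg_bounded[OF blA] by (auto simp: mult.commute)
  have split: "F' (d, q) = F' (d, 0) + q * B" for d q
  proof -
    have "F' (d, q) = F' ((d, 0) + q *\<^sub>R (0, 1))" by simp
    also have "\<dots> = F' (d, 0) + q * B"
      unfolding B_def linear_add[OF bounded_linear.linear[OF bl]]
        linear_scale[OF bounded_linear.linear[OF bl]] by simp
    finally show ?thesis .
  qed
  \<comment> \<open>\<open>C\<close> is the Lipschitz constant of \<open>g\<close> at \<open>a\<close> that the crude estimate produces\<close>
  define C where "C = 2 * K / \<bar>B\<bar> + 1"
  have C: "1 \<le> C" using K(1) B by (simp add: C_def)
  have "\<forall>\<^sub>F x in nhds a.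
      norm (g x - g a - (- F' (x - a, 0) / B)) \<le> e * norm (x - a)" if "0 < e" for e
  proof -
    \<comment> \<open>the first bound serves the Lipschitz estimate; given it, the error is at most
      \<open>e' * (1 + C) * norm (x - a)\<close>, and the second bound makes this small enough\<close>
    define e' where "e' = min (\<bar>B\<bar> / 2) (e * \<bar>B\<bar> / (1 + C))"
    have e': "0 < e'" "e' \<le> \<bar>B\<bar> / 2" "e' * (1 + C) \<le> e * \<bar>B\<bar>"
    proof -
      show "0 < e'" using that B C by (simp add: e'_def)
      show "e' \<le> \<bar>B\<bar> / 2" unfolding e'_def by (rule min.cobounded1)
      have "e' \<le> e * \<bar>B\<bar> / (1 + C)" unfolding e'_def by (rule min.cobounded2)
      then show "e' * (1 + C) \<le> e * \<bar>B\<bar>" using C by (simp add: pos_le_divide_eq)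
    qed
    obtain \<delta> where \<delta>: "0 < \<delta>" "\<And>z. norm (z - (a, g a)) < \<delta> \<Longrightarrow>
        norm (F z - F (a, g a) - F' (z - (a, g a))) \<le> e' * norm (z - (a, g a))"
      using F e'(1) unfolding has_derivative_at_alt by meson
    have "((\<lambda>x. (x, g x)) \<longlongrightarrow> (a, g a)) (nhds a)"
      using cont by (intro tendsto_Pair) (auto simp: filterlim_ident isCont_def tendsto_at_iff_tendsto_nhds)
    then have "\<forall>\<^sub>F x in nhds a. norm ((x, g x) - (a, g a)) < \<delta>"
      unfolding dist_norm[symmetric] by (rule tendstoD[OF _ \<delta>(1)])
    with level show ?thesis
    proof eventually_elim
      case (elim x)
      let ?n = "norm (x - a)" and ?q = "\<bar>g x - g a\<bar>"
      have "\<bar>F' (x - a, 0) + (g x - g a) * B\<bar> \<le> e' * norm (x - a, g x - g a)"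
        using \<delta>(2)[OF elim(2)] elim(1) split[of "x - a" "g x - g a"] by simp
      also have "\<dots> \<le> e' * (?n + ?q)"
        using e'(1) norm_Pair_le[of "x - a" "g x - g a"] by (intro mult_left_mono) auto
      finally have err: "\<bar>F' (x - a, 0) + (g x - g a) * B\<bar> \<le> e' * (?n + ?q)" .
      have "?q * \<bar>B\<bar> \<le> K * ?n + e' * (?n + ?q)"
        using err K(2)[of "x - a"] unfolding abs_mult[symmetric] by linarith
      also have "\<dots> \<le> K * ?n + \<bar>B\<bar> / 2 * (?n + ?q)"
        using e'(2) by (intro add_left_mono mult_right_mono) auto
      finally have "?q * \<bar>B\<bar> \<le> (2 * K + \<bar>B\<bar>) * ?n" by (simp add: field_simps)
      also have "2 * K + \<bar>B\<bar> = C * \<bar>B\<bar>" using B by (simp add: C_def field_simps)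
      finally have "?q * \<bar>B\<bar> \<le> (C * ?n) * \<bar>B\<bar>" by (simp add: mult_ac)
      then have lip: "?q \<le> C * ?n" using B by simp
      have "\<bar>F' (x - a, 0) + (g x - g a) * B\<bar> \<le> e' * (?n + C * ?n)"
        using err lip e'(1) mult_left_mono[of "?n + ?q" "?n + C * ?n" e'] by linarith
      also have "\<dots> = e' * (1 + C) * ?n" by (simp add: algebra_simps)
      also have "\<dots> \<le> e * \<bar>B\<bar> * ?n" using e'(3) by (intro mult_right_mono) auto
      finally have "\<bar>F' (x - a, 0) + (g x - g a) * B\<bar> / \<bar>B\<bar> \<le> e * ?n"
        using B by (simp add: field_simps)
      moreover have "g x - g a - (- F' (x - a, 0) / B) = (F' (x - a, 0) + (g x - g a) * B) / B"
        using B by (simp add: field_simps)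
      ultimately show ?case by simp
    qed
  qed
  moreover have "bounded_linear (\<lambda>d. - F' (d, 0) / B)"
    using bounded_linear_compose[OF bounded_linear_mult_left[of "- inverse B"] blA]
    by (simp add: field_simps)
  ultimately show ?thesis
    unfolding has_derivative_at_alt B_def[symmetric]
    by (force simp: eventually_nhds_metric dist_norm)
qed

text \<open>
  The bootstrap: the formula for \<open>g'\<close> expresses it through \<open>g\<close> and the smooth map \<open>F'\<close>, so each
  degree of regularity of \<open>g\<close> produces the next one.
\<close>

lemma Ck_on_implicit:
  fixes F :: "'a::euclidean_space \<times> real \<Rightarrow> real"
  assumes "open S" "open U" and F: "\<And>k. Ck_on k F U"
    and graph: "\<And>x. x \<in> S \<Longrightarrow> (x, g x) \<in> U"
    and zero: "\<And>x. x \<in> S \<Longrightarrow> F (x, g x) = 0"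
    and nz: "\<And>x. x \<in> S \<Longrightarrow> frechet_derivative F (at (x, g x)) (0, 1) \<noteq> 0"
    and cont: "continuous_on S g"
  shows "Ck_on k g S"
proof (induction k)
  case 0
  then show ?case using cont by simp
next
  case (Suc k)
  let ?D = "\<lambda>x. frechet_derivative F (at (x, g x))"
  have D: "Ck_on k (\<lambda>x. ?D x d) S" for d
  proof (rule Ck_on_compose[OF assms(1,2)])
    show "(\<lambda>x. (x, g x)) ` S \<subseteq> U" using graph by auto
    show "Ck_on k (\<lambda>z. frechet_derivative F (at z) d) U" using F[of "Suc k"] unfolding Ck_on.simps by blast
    show "Ck_on k (\<lambda>x. (x, g x)) S" by (intro Ck_on_Pair Ck_on_ident assms(1) Suc.IH)
  qed
  show ?case
  proof (rule Ck_on_SucI[OF assms(1)])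
    fix x assume x: "x \<in> S"
    show "(g has_derivative (\<lambda>d. - ?D x (d, 0) / ?D x (0, 1))) (at x)"
    proof (rule has_derivative_implicit)
      show "(F has_derivative ?D x) (at (x, g x))"
        using Ck_on_has_derivative[OF F graph[OF x]] .
      show "?D x (0, 1) \<noteq> 0" using nz[OF x] .
      show "isCont g x" using cont assms(1) x by (simp add: continuous_on_eq_continuous_at)
      show "\<forall>\<^sub>F y in nhds x. F (y, g y) = F (x, g x)"
        using eventually_nhds_in_open[OF assms(1) x] by eventually_elim (simp add: zero x)
    qed
  next
    fix d
    show "Ck_on k (\<lambda>x. - ?D x (d, 0) / ?D x (0, 1)) S"
      unfolding divide_inverse
      by (intro Ck_on_mult Ck_on_minus Ck_on_inverse D assms(1) nz)
  qed
qed

section \<open>Smoothness of \<open>p_star\<close>\<close>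

abbreviation unit_cube :: "(real \<times> real \<times> real) set" where
  "unit_cube \<equiv> {0<..<1} \<times> {0<..<1} \<times> {0<..<1}"

abbreviation h_uncurried :: "(real \<times> real \<times> real) \<times> real \<Rightarrow> real" where
  "h_uncurried \<equiv> \<lambda>((u, v, w), p). h u v w p"

lemma open_unit_cube_times: "open (unit_cube \<times> {0::real<..})"
  by (intro open_Times) auto

lemma Ck_on_h: "Ck_on k h_uncurried (unit_cube \<times> {0<..})"
proof -
  let ?U = "unit_cube \<times> {0::real<..}"
  let ?u = "\<lambda>z::(real \<times> real \<times> real) \<times> real. fst (fst z)"
    and ?v = "\<lambda>z::(real \<times> real \<times> real) \<times> real. fst (snd (fst z))"
    and ?w = "\<lambda>z::(real \<times> real \<times> real) \<times> real. snd (snd (fst z))"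
    and ?p = "\<lambda>z::(real \<times> real \<times> real) \<times> real. snd z"
  note U = open_unit_cube_times
  have coords: "Ck_on k ?u ?U" "Ck_on k ?v ?U" "Ck_on k ?w ?U" "Ck_on k ?p ?U"
    by (intro Ck_on_linear[OF bounded_linear_fst] Ck_on_linear[OF bounded_linear_snd]
        Ck_on_ident U)+
  have prod: "u * v < 1" if "0 < u" "u < 1" "0 < v" "v < 1" for u v :: real
    using mult_strict_mono[of u 1 v 1] that by simp
  have "Ck_on k (\<lambda>z. ln (1 - ?u z powr ?p z) + ln (1 - ?v z powr ?p z)
      - 2 * ln (1 - (?u z * ?v z) powr ?p z) - ?p z * ln (?w z)) ?U"
    by (intro Ck_on_add Ck_on_diff Ck_on_mult Ck_on_ln Ck_on_powr Ck_on_const coords U)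
      (auto simp: powr_lt_one prod)
  then show ?thesis by (simp add: h_def case_prod_unfold)
qed

lemma frechet_derivative_h_pos:
  assumes "(x, p) \<in> unit_cube \<times> {0<..}"
  shows "0 < frechet_derivative h_uncurried (at (x, p)) (0, 1)"
proof -
  obtain u v w where x: "x = (u, v, w)" by (cases x)
  let ?D = "frechet_derivative h_uncurried (at (x, p))"
  have D: "(h_uncurried has_derivative ?D) (at (x, p))"
    using Ck_on_has_derivative[OF Ck_on_h assms] .
  have "((\<lambda>q. (x, q)) has_derivative (\<lambda>t. (0, t))) (at p)"
    by (intro has_derivative_Pair has_derivative_const has_derivative_ident)
  from has_derivative_compose[OF this D]
  have "(h u v w has_derivative (\<lambda>t. ?D (0, t))) (at p)" by (simp add: x)
  moreover obtain E where "0 < E" "(h u v w has_derivative (\<lambda>t. E * t)) (at p)"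
    using h_has_derivative[of u v w p] assms
    by (auto simp: x has_field_derivative_def)
  ultimately have "(\<lambda>t. ?D (0, t)) = (\<lambda>t. E * t)" using has_derivative_unique by blast
  then show ?thesis using \<open>0 < E\<close> by (metis mult.right_neutral)
qed

lemma p_star_zero:
  assumes "x \<in> Omega"
  shows "0 < p_star x" "h_uncurried (x, p_star x) = 0"
proof -
  obtain u v w where x: "x = (u, v, w)" by (cases x)
  show "0 < p_star x" "h_uncurried (x, p_star x) = 0"
    using theI'[OF p_star_well_defined(1)[of u v w]] assms by (auto simp: x p_star_def)
qed

lemma Omega_subset_unit_cube: "Omega \<subseteq> unit_cube"
  by (auto simp: Omega_def)

lemma continuous_on_p_star: "continuous_on Omega p_star"
proof (rule continuous_on_zero_of_strict_mono[where F = h_uncurried and P = "{0<..}"])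
  show "continuous_on (Omega \<times> {0<..}) h_uncurried"
    using Ck_on_h[of 0] Omega_subset_unit_cube by (auto intro: continuous_on_subset)
  show "strict_mono_on {0<..} (\<lambda>p. h_uncurried (x, p))" if "x \<in> Omega" for x
    using that by (auto simp: Omega_def intro!: strict_mono_onI h_strict_mono)
qed (use p_star_zero open_Omega in auto)

theorem theorem3p1:
  shows "p_star \<in> Omega \<rightarrow> {0<..<1} \<and> C_infinity_on p_star Omega"
proof
  show "p_star \<in> Omega \<rightarrow> {0<..<1}"
    using p_star_zero p_star_well_defined(2) by fastforce
  have graph: "(x, p_star x) \<in> unit_cube \<times> {0<..}" if "x \<in> Omega" for x
    using that p_star_zero(1) Omega_subset_unit_cube by auto
  have "Ck_on k p_star Omega" for k
    using frechet_derivative_h_pos[OF graph]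
    by (intro Ck_on_implicit[OF open_Omega open_unit_cube_times Ck_on_h graph p_star_zero(2) _
          continuous_on_p_star]) (auto simp: less_le)
  then show "C_infinity_on p_star Omega" by (simp add: C_infinity_on_def)
qed

end
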